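(* Let $\Gamma=(G,\sigma)$ be a signed graph, let $u,v$ be two distinct vertices of $\Gamma$, let $vv_1,\dots,vv_s$ ($s\ge 1$) be pendant edges of $\Gamma$ (each $v_i$ having degree 1) with $u\notin\{v_1,\dots,v_s\}$, and let $\mathbf x$ be an eigenvector of $A(\Gamma)$ corresponding to the index $\lambda(\Gamma)$. Let $$\Gamma'=\Gamma-vv_1-\cdots-vv_s+uv_1+\cdots+uv_s,$$ where each new edge $uv_i$ has the sign $\sigma(vv_i)$. If $x_u\ge x_v\ge 0$ or $x_u\le x_v\le 0$, then $\lambda(\Gamma')\ge\lambda(\Gamma)$. Furthermore, if $x_u>x_v>0$ or $x_u<x_v<0$, then $\lambda(\Gamma')>\lambda(\Gamma)$.
   Context: A signed graph $\Gamma=(G,\sigma)$ is a finite simple graph $G$ with a map $\sigma:E(G)\to\{+1,-1\}$. Its adjacency matrix $A(\Gamma)$ has $(u,v)$ entry $\sigma(uv)$ if $uv\in E(G)$ and $0$ otherwise; the index $\lambda(\Gamma)$ is the largest eigenvalue of $A(\Gamma)$. For a vector $\mathbf x$ indexed by vertices, $x_u$ is its entry at $u$. *)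

theory Defs
  imports "HOL-Analysis.Analysis"
begin

text \<open>
  The vertex set is the whole finite type \<open>'v\<close>; edges are unordered pairs of distinct vertices.
  The sign function is total, but only its values on the edges carry information.
\<close>

record 'v signed_graph =
  edges :: "'v set set"
  sigma :: "'v set \<Rightarrow> int"

definition is_signed_graph :: "('v::finite) signed_graph \<Rightarrow> bool" where
  "is_signed_graph \<Gamma> \<longleftrightarrow>
     (\<forall>e\<in>edges \<Gamma>. card e = 2) \<and> (\<forall>e\<in>edges \<Gamma>. sigma \<Gamma> e \<in> {1, -1})"

definition vertex_degree :: "('v::finite) signed_graph \<Rightarrow> 'v \<Rightarrow> nat" where
  "vertex_degree \<Gamma> w = card {e \<in> edges \<Gamma>. w \<in> e}"

definition adj_matrix :: "('v::finite) signed_graph \<Rightarrow> real ^ 'v ^ 'v" where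
  "adj_matrix \<Gamma> =
     (\<chi> a b. if {a, b} \<in> edges \<Gamma> then of_int (sigma \<Gamma> {a, b}) else 0)"

definition eigenvector_of :: "real ^ 'n ^ 'n \<Rightarrow> real ^ 'n \<Rightarrow> real \<Rightarrow> bool" where
  "eigenvector_of A x c \<longleftrightarrow> x \<noteq> 0 \<and> A *v x = c *\<^sub>R x"

definition eigenvalue_of :: "real ^ 'n ^ 'n \<Rightarrow> real \<Rightarrow> bool" where
  "eigenvalue_of A c \<longleftrightarrow> (\<exists>x. eigenvector_of A x c)"

text \<open>
  The adjacency matrix is real symmetric, so its real eigenvalues, over which the maximum is taken,
  are all its eigenvalues and form a finite nonempty set.
\<close>

definition graph_index :: "('v::finite) signed_graph \<Rightarrow> real" where
  "graph_index \<Gamma> = Max {c. eigenvalue_of (adj_matrix \<Gamma>) c}"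

definition delete_edges :: "('v::finite) signed_graph \<Rightarrow> 'v set set \<Rightarrow> 'v signed_graph" where
  "delete_edges \<Gamma> F = \<Gamma>\<lparr>edges := edges \<Gamma> - F\<rparr>"

definition add_edges ::
  "('v::finite) signed_graph \<Rightarrow> 'v set set \<Rightarrow> ('v set \<Rightarrow> int) \<Rightarrow> 'v signed_graph" where
  "add_edges \<Gamma> F \<tau> =
     \<Gamma>\<lparr>edges := edges \<Gamma> \<union> F, sigma := (\<lambda>e. if e \<in> F then \<tau> e else sigma \<Gamma> e)\<rparr>"

text \<open>
  Replace every edge \<open>vw\<close>, \<open>w \<in> W\<close>, by \<open>uw\<close> with the sign of \<open>vw\<close>.  For \<open>u \<notin> W\<close> the end \<open>w\<close> of a
  new edge \<open>e = uw\<close> is recovered from \<open>e - {u} = {w}\<close>, so \<open>insert v (e - {u})\<close> is the old edge \<open>vw\<close>.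
\<close>

definition move_edges ::
  "('v::finite) signed_graph \<Rightarrow> 'v \<Rightarrow> 'v \<Rightarrow> 'v set \<Rightarrow> 'v signed_graph" where
  "move_edges \<Gamma> v u W =
     add_edges (delete_edges \<Gamma> ((\<lambda>w. {v, w}) ` W)) ((\<lambda>w. {u, w}) ` W)
       (\<lambda>e. sigma \<Gamma> (insert v (e - {u})))"

lemma sigma_move_edges:
  assumes "w \<in> W" and "u \<notin> W"
  shows "sigma (move_edges \<Gamma> v u W) {u, w} = sigma \<Gamma> {v, w}"
proof -
  from assms have "{u, w} - {u} = {w}" by auto
  with assms show ?thesis by (simp add: move_edges_def add_edges_def)
qed

lemma is_signed_graph_move_edges:
  assumes "is_signed_graph \<Gamma>" and "u \<notin> W" and "\<And>w. w \<in> W \<Longrightarrow> {v, w} \<in> edges \<Gamma>"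
  shows "is_signed_graph (move_edges \<Gamma> v u W)"
  unfolding is_signed_graph_def
proof (intro conjI ballI)
  fix e assume e: "e \<in> edges (move_edges \<Gamma> v u W)"
  then have cases: "e \<in> edges \<Gamma> \<or> (\<exists>w\<in>W. e = {u, w})"
    by (auto simp: move_edges_def add_edges_def delete_edges_def)
  then show "card e = 2"
    using assms(1,2) by (auto simp: is_signed_graph_def card_2_iff)
  show "sigma (move_edges \<Gamma> v u W) e \<in> {1, -1}"
  proof (cases "e \<in> (\<lambda>w. {u, w}) ` W")
    case True
    then obtain w where w: "w \<in> W" "e = {u, w}" by blast
    then show ?thesis
      using assms sigma_move_edges[of w W u \<Gamma> v] by (simp add: is_signed_graph_def)
  next
    case False
    then have "e \<in> edges \<Gamma>" using cases by blast
    with False assms(1) show ?thesis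
      by (simp add: move_edges_def add_edges_def delete_edges_def is_signed_graph_def)
  qed
qed

end

theory Submission
  imports Defs
begin

text \<open>
  The Rayleigh quotient of \<open>x\<close> for the new adjacency matrix is a lower bound for the new index.
  Moving the edges changes the quadratic form at \<open>x\<close> by \<open>2 (x\<^sub>u - x\<^sub>v) (\<Sum>w. \<sigma>(vw) x\<^sub>w)\<close>, and the
  eigenvalue equation at a pendant vertex \<open>w\<close> reads \<open>\<lambda> x\<^sub>w = \<sigma>(vw) x\<^sub>v\<close>. Since \<open>\<lambda> > 0\<close> as
  soon as there is an edge, the change has the sign of \<open>(x\<^sub>u - x\<^sub>v) x\<^sub>v\<close>. The new index is therefore
  at least the old one, strictly if this product is positive.
\<close>

section \<open>The largest eigenvalue of a symmetric matrix\<close>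

lemma symmetric_matrix_inner:
  fixes A :: "real ^ 'n ^ 'n"
  assumes "transpose A = A"
  shows "(A *v x) \<bullet> y = x \<bullet> (A *v y)"
  by (metis assms dot_lmul_matrix transpose_matrix_vector)

text \<open>Eigenvectors of a symmetric matrix for distinct eigenvalues are orthogonal, so choosing
  one per eigenvalue gives an independent, hence finite, family. This is what lets
  \<open>Max\<close> bound every eigenvalue from above.\<close>

lemma finite_eigenvalues_symmetric:
  fixes A :: "real ^ 'n ^ 'n"
  assumes sym: "transpose A = A"
  shows "finite {c. eigenvalue_of A c}"
proof -
  define f where "f c = (SOME x. eigenvector_of A x c)" for c
  have f: "eigenvector_of A (f c) c" if "eigenvalue_of A c" for c
    using that unfolding f_def eigenvalue_of_def by (rule someI_ex)
  have orth: "f c \<bullet> f d = 0" if "eigenvalue_of A c" "eigenvalue_of A d" "c \<noteq> d" for c d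
  proof -
    have "c * (f c \<bullet> f d) = d * (f c \<bullet> f d)"
      using symmetric_matrix_inner[OF sym, of "f c" "f d"] f[OF that(1)] f[OF that(2)]
      by (simp add: eigenvector_of_def)
    with that(3) show ?thesis by simp
  qed
  \<comment> \<open>A vector chosen for two distinct eigenvalues would be orthogonal to itself,
    hence zero.\<close>
  have inj: "inj_on f {c. eigenvalue_of A c}"
  proof (rule inj_onI, rule ccontr)
    fix c d assume "c \<in> {c. eigenvalue_of A c}" "d \<in> {c. eigenvalue_of A c}" "f c = f d" "c \<noteq> d"
    then show False using orth[of c d] f[of d] by (simp add: eigenvector_of_def)
  qed
  have "pairwise orthogonal (f ` {c. eigenvalue_of A c})"
    using orth by (auto simp: pairwise_def orthogonal_def)
  moreover have "0 \<notin> f ` {c. eigenvalue_of A c}"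
    using f by (auto simp: eigenvector_of_def)
  ultimately have "finite (f ` {c. eigenvalue_of A c})"
    by (intro independent_imp_finite pairwise_orthogonal_independent)
  then show ?thesis
    using inj by (rule finite_imageD)
qed

text \<open>If \<open>M *v x\<close> were nonzero, a small step from \<open>x\<close> against it
  would make the form negative: the linear term of the expansion in \<open>t\<close> outweighs the
  quadratic one.\<close>

lemma psd_isotropic_imp_kernel:
  fixes M :: "real ^ 'n ^ 'n"
  assumes sym: "transpose M = M"
    and psd: "\<And>y. 0 \<le> y \<bullet> (M *v y)"
    and iso: "x \<bullet> (M *v x) = 0"
  shows "M *v x = 0"
proof (rule ccontr)
  define y where "y = M *v x"
  define p where "p = y \<bullet> y"
  define c where "c = y \<bullet> (M *v y)"
  assume "M *v x \<noteq> 0"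
  then have "p > 0" by (simp add: p_def y_def)
  have "c \<ge> 0" using psd by (simp add: c_def)
  have expand: "0 \<le> 2 * t * p + t\<^sup>2 * c" for t
  proof -
    have "(x + t *\<^sub>R y) \<bullet> (M *v (x + t *\<^sub>R y)) = 2 * t * p + t\<^sup>2 * c"
      using iso symmetric_matrix_inner[OF sym, of x y]
      by (simp add: matrix_vector_right_distrib matrix_vector_mult_scaleR inner_add_left
          inner_add_right power2_eq_square c_def p_def algebra_simps flip: y_def)
    then show ?thesis using psd by metis
  qed
  \<comment> \<open>The minimum over \<open>t\<close> would be at \<open>- p / c\<close>; the
    denominator \<open>c + 1\<close> also covers \<open>c = 0\<close> and still leaves
    \<open>2 * p + t * c\<close> positive.\<close>
  define t where "t = - p / (c + 1)"
  have "t < 0" using \<open>p > 0\<close> \<open>c \<ge> 0\<close> by (simp add: t_def divide_neg_pos)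
  have "t * (c + 1) = - p" using \<open>c \<ge> 0\<close> by (simp add: t_def)
  then have "t * c > - 2 * p" using \<open>t < 0\<close> \<open>p > 0\<close> by (simp add: algebra_simps)
  then have "t * (2 * p + t * c) < 0"
    using \<open>t < 0\<close> by (simp add: mult_neg_pos)
  with expand[of t] show False by (simp add: algebra_simps power2_eq_square)
qed

text \<open>On the compact unit sphere the form attains its maximum \<mu> at some \<open>x\<close>.
  Then \<mu> times the identity minus \<open>A\<close> is positive semidefinite and vanishes as a
  form at \<open>x\<close>, so \<open>x\<close> lies in its kernel and is an eigenvector for
  \<mu>.\<close>

lemma symmetric_matrix_max_eigenvalue:
  fixes A :: "real ^ 'n ^ 'n"
  assumes sym: "transpose A = A"
  obtains \<mu> where "eigenvalue_of A \<mu>" "\<And>y. y \<bullet> (A *v y) \<le> \<mu> * (y \<bullet> y)"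
proof -
  obtain x :: "real ^ 'n" where x: "norm x = 1"
    and max: "\<And>y. norm y = 1 \<Longrightarrow> y \<bullet> (A *v y) \<le> x \<bullet> (A *v x)"
  proof -
    have "continuous_on (sphere 0 1) (\<lambda>y. y \<bullet> (A *v y))"
      by (intro continuous_intros)
    moreover have "sphere (0 :: real ^ 'n) 1 \<noteq> {}" by simp
    ultimately show ?thesis
      using continuous_attains_sup[OF compact_sphere, of 0 1 "\<lambda>y. y \<bullet> (A *v y)"] that
      by auto
  qed
  define \<mu> where "\<mu> = x \<bullet> (A *v x)"
  have bound: "y \<bullet> (A *v y) \<le> \<mu> * (y \<bullet> y)" for y
  proof (cases "y = 0")
    case False
    define z where "z = (1 / norm y) *\<^sub>R y"
    have "norm z = 1" and y: "y = norm y *\<^sub>R z"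
      using False by (simp_all add: z_def)
    have "y \<bullet> (A *v y) = (norm y)\<^sup>2 * (z \<bullet> (A *v z))"
      by (subst (1 2) y) (simp add: matrix_vector_mult_scaleR power2_eq_square)
    also have "\<dots> \<le> (norm y)\<^sup>2 * \<mu>"
      using max[OF \<open>norm z = 1\<close>] by (simp add: \<mu>_def mult_left_mono)
    finally show ?thesis by (simp add: power2_norm_eq_inner mult.commute)
  qed simp
  define M where "M = \<mu> *\<^sub>R mat 1 - A"
  have M: "M *v y = \<mu> *\<^sub>R y - A *v y" for y
    by (simp add: M_def matrix_vector_mult_diff_rdistrib scaleR_matrix_vector_assoc[symmetric])
  have "transpose M = M"
    using sym by (auto simp: M_def transpose_def vec_eq_iff mat_def)
  then have "M *v x = 0"
  proof (rule psd_isotropic_imp_kernel)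
    show "0 \<le> y \<bullet> (M *v y)" for y
      using bound[of y] by (simp add: M inner_diff_right)
    show "x \<bullet> (M *v x) = 0"
      using x by (simp add: M inner_diff_right \<mu>_def flip: power2_norm_eq_inner)
  qed
  with x have "eigenvector_of A x \<mu>"
    by (auto simp: eigenvector_of_def M)
  then have "eigenvalue_of A \<mu>"
    unfolding eigenvalue_of_def ..
  with bound show ?thesis by (rule that[rotated])
qed

lemma quadratic_form_le_Max_eigenvalue:
  fixes A :: "real ^ 'n ^ 'n"
  assumes "transpose A = A"
  shows "y \<bullet> (A *v y) \<le> Max {c. eigenvalue_of A c} * (y \<bullet> y)"
proof -
  obtain \<mu> where \<mu>: "eigenvalue_of A \<mu>" "y \<bullet> (A *v y) \<le> \<mu> * (y \<bullet> y)"
    using symmetric_matrix_max_eigenvalue[OF assms] by metis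
  have "\<mu> \<le> Max {c. eigenvalue_of A c}"
    using \<mu>(1) finite_eigenvalues_symmetric[OF assms] by (intro Max_ge) auto
  then have "\<mu> * (y \<bullet> y) \<le> Max {c. eigenvalue_of A c} * (y \<bullet> y)"
    by (simp add: mult_right_mono)
  with \<mu>(2) show ?thesis by linarith
qed

section \<open>Signed graphs\<close>

lemma transpose_adj_matrix: "transpose (adj_matrix \<Gamma>) = adj_matrix \<Gamma>"
  by (simp add: transpose_def adj_matrix_def vec_eq_iff insert_commute)

lemma quadratic_form_le_graph_index:
  "y \<bullet> (adj_matrix \<Gamma> *v y) \<le> graph_index \<Gamma> * (y \<bullet> y)"
  unfolding graph_index_def by (rule quadratic_form_le_Max_eigenvalue[OF transpose_adj_matrix])

lemma edge_neq:
  assumes "is_signed_graph \<Gamma>" and "{a, b} \<in> edges \<Gamma>"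
  shows "a \<noteq> b"
  using assms by (auto simp: is_signed_graph_def)

lemma adj_matrix_same:
  assumes "is_signed_graph \<Gamma>"
  shows "adj_matrix \<Gamma> $ a $ a = 0"
  using edge_neq[OF assms, of a a] by (auto simp: adj_matrix_def)

text \<open>A single edge already yields a vector with positive quadratic form. Positivity later
  permits division by the index.\<close>

lemma graph_index_pos:
  assumes \<Gamma>: "is_signed_graph \<Gamma>" and e: "{a, b} \<in> edges \<Gamma>"
  shows "graph_index \<Gamma> > 0"
proof -
  let ?A = "adj_matrix \<Gamma>"
  define t :: real where "t = of_int (sigma \<Gamma> {a, b})"
  \<comment> \<open>Weighting \<open>b\<close> by the sign of the edge makes both cross terms equal
    to \<open>t * t = 1\<close>, whatever the sign.\<close>
  define y :: "real ^ 'a" where "y = axis a 1 + t *\<^sub>R axis b 1"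
  have "sigma \<Gamma> {a, b} \<in> {1, -1}" using \<Gamma> e by (auto simp: is_signed_graph_def)
  then have t: "t * t = 1" by (auto simp: t_def)
  have entries: "?A $ a $ a = 0" "?A $ b $ b = 0" "?A $ a $ b = t" "?A $ b $ a = t"
    using adj_matrix_same[OF \<Gamma>] e by (simp_all add: adj_matrix_def t_def insert_commute)
  have "y \<bullet> (?A *v y) = 2"
    using t entries
    by (simp add: y_def matrix_vector_right_distrib matrix_vector_mult_scaleR inner_add_left
        inner_add_right matrix_vector_mult_basis inner_axis' column_def)
  then have "0 < graph_index \<Gamma> * (y \<bullet> y)"
    using quadratic_form_le_graph_index[of y \<Gamma>] by linarith
  then show ?thesis
    using inner_ge_zero[of y] by (auto simp: zero_less_mult_iff)
qed

lemma pendant_edge_unique: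
  assumes "vertex_degree \<Gamma> w = 1" and "{v, w} \<in> edges \<Gamma>" and "e \<in> edges \<Gamma>" and "w \<in> e"
  shows "e = {v, w}"
proof -
  have "card {e \<in> edges \<Gamma>. w \<in> e} = 1"
    using assms(1) by (simp add: vertex_degree_def)
  then obtain e' where e': "{e \<in> edges \<Gamma>. w \<in> e} = {e'}"
    by (rule card_1_singletonE)
  have "e \<in> {e'}" and "{v, w} \<in> {e'}"
    unfolding e'[symmetric] using assms(2-4) by simp_all
  then show ?thesis by simp
qed

text \<open>The only edge at \<open>w\<close> is \<open>{v, w}\<close>, so row \<open>w\<close> of
  the matrix is supported in column \<open>v\<close> and the eigenvalue equation at \<open>w\<close>
  has a single term.\<close>

lemma pendant_eigenvector_equation:
  assumes \<Gamma>: "is_signed_graph \<Gamma>" and deg: "vertex_degree \<Gamma> w = 1" and e: "{v, w} \<in> edges \<Gamma>"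
    and x: "eigenvector_of (adj_matrix \<Gamma>) x c"
  shows "c * x $ w = of_int (sigma \<Gamma> {v, w}) * x $ v"
proof -
  have row: "adj_matrix \<Gamma> $ w $ b = (if b = v then of_int (sigma \<Gamma> {v, w}) else 0)" for b
    using pendant_edge_unique[OF deg e, of "{w, b}"] edge_neq[OF \<Gamma>, of w b] e
    by (auto simp: adj_matrix_def insert_commute doubleton_eq_iff)
  have "c * x $ w = (adj_matrix \<Gamma> *v x) $ w"
    using x by (simp add: eigenvector_of_def)
  also have "\<dots> = of_int (sigma \<Gamma> {v, w}) * x $ v"
    by (simp add: matrix_vector_mult_def row if_distrib[of "\<lambda>z. z * _"] cong: if_cong)
  finally show ?thesis .
qed

section \<open>Effect of moving edges on the quadratic form\<close>

lemma quadratic_form_expand: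
  fixes A :: "real ^ 'n ^ 'n"
  shows "x \<bullet> (A *v x) = (\<Sum>a\<in>UNIV. \<Sum>b\<in>UNIV. A $ a $ b * (x $ a * x $ b))"
  by (simp add: inner_vec_def matrix_vector_mult_def sum_distrib_left algebra_simps)

text \<open>The change is written as a sum of four corrections, each confined to one row or column,
  so that the quadratic form splits by linearity. Adding the sign at a new edge is exact because
  \<open>new\<close> makes the old entry there zero.\<close>

lemma adj_matrix_move_edges:
  assumes u: "u \<noteq> v" "u \<notin> W" and v: "v \<notin> W"
    and old: "\<And>w. w \<in> W \<Longrightarrow> {v, w} \<in> edges \<Gamma>"
    and new: "\<And>w. w \<in> W \<Longrightarrow> {u, w} \<notin> edges \<Gamma>"
  shows "adj_matrix (move_edges \<Gamma> v u W) $ a $ b = adj_matrix \<Gamma> $ a $ b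
    + (if a = u then if b \<in> W then of_int (sigma \<Gamma> {v, b}) else 0 else 0)
    + (if b = u then if a \<in> W then of_int (sigma \<Gamma> {v, a}) else 0 else 0)
    - (if a = v then if b \<in> W then of_int (sigma \<Gamma> {v, b}) else 0 else 0)
    - (if b = v then if a \<in> W then of_int (sigma \<Gamma> {v, a}) else 0 else 0)"
proof -
  have moved: "{a, b} \<in> (\<lambda>w. {z, w}) ` W \<longleftrightarrow> a = z \<and> b \<in> W \<or> b = z \<and> a \<in> W" for z a b
    by (auto simp: doubleton_eq_iff)
  have edges: "{a, b} \<in> edges (move_edges \<Gamma> v u W) \<longleftrightarrow>
      {a, b} \<in> edges \<Gamma> \<and> \<not> (a = v \<and> b \<in> W \<or> b = v \<and> a \<in> W) \<or> (a = u \<and> b \<in> W \<or> b = u \<and> a \<in> W)" for a b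
    by (simp add: move_edges_def add_edges_def delete_edges_def moved)
  have kept: "sigma (move_edges \<Gamma> v u W) {a, b} = sigma \<Gamma> {a, b}"
    if "\<not> (a = u \<and> b \<in> W \<or> b = u \<and> a \<in> W)"
  proof -
    have "{a, b} \<notin> (\<lambda>w. {u, w}) ` W" using that moved by blast
    then show ?thesis by (simp add: move_edges_def add_edges_def delete_edges_def)
  qed
  \<comment> \<open>Since \<open>u\<close> and \<open>v\<close> are distinct and lie outside
    \<open>W\<close>, exactly one correction is active in each of the first four cases, and none in
    the last.\<close>
  consider "a = u" "b \<in> W" | "b = u" "a \<in> W" | "a = v" "b \<in> W" | "b = v" "a \<in> W"
    | "\<not> (a = u \<and> b \<in> W)" "\<not> (b = u \<and> a \<in> W)" "\<not> (a = v \<and> b \<in> W)" "\<not> (b = v \<and> a \<in> W)"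
    by blast
  then show ?thesis
  proof cases
    case 1
    then show ?thesis
      using u v new[of b] sigma_move_edges[of b W u \<Gamma> v] by (auto simp: adj_matrix_def edges)
  next
    case 2
    then show ?thesis
      using u v new[of a] sigma_move_edges[of a W u \<Gamma> v]
      by (auto simp: adj_matrix_def edges insert_commute)
  next
    case 3
    then show ?thesis
      using u v old[of b] by (auto simp: adj_matrix_def edges)
  next
    case 4
    then show ?thesis
      using u v old[of a] by (auto simp: adj_matrix_def edges insert_commute)
  next
    case 5
    then show ?thesis
      using kept by (auto simp: adj_matrix_def edges)
  qed
qed

lemma quadratic_form_move_edges:
  assumes "u \<noteq> v" "u \<notin> W" "v \<notin> W"
    and "\<And>w. w \<in> W \<Longrightarrow> {v, w} \<in> edges \<Gamma>"
    and "\<And>w. w \<in> W \<Longrightarrow> {u, w} \<notin> edges \<Gamma>"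
  shows "x \<bullet> (adj_matrix (move_edges \<Gamma> v u W) *v x) = x \<bullet> (adj_matrix \<Gamma> *v x)
    + 2 * (x $ u - x $ v) * (\<Sum>w\<in>W. of_int (sigma \<Gamma> {v, w}) * x $ w)"
proof -
  \<comment> \<open>Extending the signs by zero outside \<open>W\<close> turns the sum over
    \<open>W\<close> into one over all vertices, as in the double sum.\<close>
  define h :: "_ \<Rightarrow> real" where "h b = (if b \<in> W then of_int (sigma \<Gamma> {v, b}) else 0)" for b
  let ?S = "\<Sum>w\<in>W. of_int (sigma \<Gamma> {v, w}) * x $ w"
  have S: "(\<Sum>b\<in>UNIV. h b * x $ b) = ?S"
    unfolding h_def by (rule sum.mono_neutral_cong_right) auto
  have row: "(\<Sum>a\<in>UNIV. \<Sum>b\<in>UNIV. (if a = z then h b else 0) * (x $ a * x $ b)) = x $ z * ?S" for z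
  proof -
    have "(\<Sum>b\<in>UNIV. (if a = z then h b else 0) * (x $ a * x $ b))
        = (if a = z then x $ z * ?S else 0)" for a
      by (simp add: sum_distrib_left mult.left_commute flip: S)
    then show ?thesis by simp
  qed
  \<comment> \<open>The column corrections are the transposes of the row corrections and contribute
    the same; hence the factor 2.\<close>
  have col: "(\<Sum>a\<in>UNIV. \<Sum>b\<in>UNIV. (if b = z then h a else 0) * (x $ a * x $ b)) = x $ z * ?S" for z
    by (subst sum.swap, subst row[of z, symmetric]) (simp add: mult.commute[of "x $ _" "x $ _"])
  have "adj_matrix (move_edges \<Gamma> v u W) $ a $ b = adj_matrix \<Gamma> $ a $ b
      + (if a = u then h b else 0) + (if b = u then h a else 0)
      - (if a = v then h b else 0) - (if b = v then h a else 0)" for a b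
    unfolding h_def using assms by (rule adj_matrix_move_edges)
  then show ?thesis
    by (simp only: quadratic_form_expand distrib_right left_diff_distrib sum.distrib sum_subtractf
        row col) (simp add: algebra_simps)
qed

theorem lemma2p4:
  fixes \<Gamma> :: "('v::finite) signed_graph"
    and u v :: 'v
    and s :: nat
    and pv :: "nat \<Rightarrow> 'v"
    and x :: "real ^ 'v"
  assumes "is_signed_graph \<Gamma>"
    and "u \<noteq> v"
    and "s \<ge> 1"
    and "inj_on pv {1..s}"
    and "\<And>i. i \<in> {1..s} \<Longrightarrow> {v, pv i} \<in> edges \<Gamma>"
    and "\<And>i. i \<in> {1..s} \<Longrightarrow> vertex_degree \<Gamma> (pv i) = 1"
    and "u \<notin> pv ` {1..s}"
    and "eigenvector_of (adj_matrix \<Gamma>) x (graph_index \<Gamma>)"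
  shows "((x $ u \<ge> x $ v \<and> x $ v \<ge> 0) \<or> (x $ u \<le> x $ v \<and> x $ v \<le> 0) \<longrightarrow>
           graph_index (move_edges \<Gamma> v u (pv ` {1..s})) \<ge> graph_index \<Gamma>) \<and>
         ((x $ u > x $ v \<and> x $ v > 0) \<or> (x $ u < x $ v \<and> x $ v < 0) \<longrightarrow>
           graph_index (move_edges \<Gamma> v u (pv ` {1..s})) > graph_index \<Gamma>)"
proof -
  define W where "W = pv ` {1..s}"
  let ?r = "graph_index \<Gamma>" and ?r' = "graph_index (move_edges \<Gamma> v u W)"
  let ?S = "\<Sum>w\<in>W. of_int (sigma \<Gamma> {v, w}) * x $ w"
  have old: "{v, w} \<in> edges \<Gamma>" and deg: "vertex_degree \<Gamma> w = 1" if "w \<in> W" for w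
    using that assms(5,6) by (auto simp: W_def)
  have "u \<notin> W" using assms(7) by (simp add: W_def)
  have "v \<notin> W" using old edge_neq[OF assms(1)] by blast
  \<comment> \<open>Such an edge would be a second one at the pendant vertex \<open>w\<close> unless
    \<open>u = v\<close>.\<close>
  have new: "{u, w} \<notin> edges \<Gamma>" if "w \<in> W" for w
    using pendant_edge_unique[OF deg[OF that] old[OF that], of "{u, w}"] \<open>u \<noteq> v\<close>
    by (auto simp: doubleton_eq_iff)
  have "card W > 0" using \<open>s \<ge> 1\<close> by (auto simp: W_def card_gt_0_iff)
  then obtain w\<^sub>0 where "w\<^sub>0 \<in> W" by (metis card_gt_0_iff ex_in_conv)
  then have pos: "?r > 0" using old graph_index_pos[OF assms(1)] by blast
  \<comment> \<open>Multiplying the pendant equation by the sign squares it away, so every moved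
    edge contributes the same amount, independent of its sign.\<close>
  have "of_int (sigma \<Gamma> {v, w}) * x $ w = x $ v / ?r" if "w \<in> W" for w
  proof -
    have "sigma \<Gamma> {v, w} \<in> {1, -1}"
      using old[OF that] assms(1) by (auto simp: is_signed_graph_def)
    with pendant_eigenvector_equation[OF assms(1) deg[OF that] old[OF that] assms(8)] pos
    show ?thesis by (auto simp: field_simps)
  qed
  then have S: "?S = real (card W) * (x $ v / ?r)" by simp
  have "x \<bullet> (adj_matrix \<Gamma> *v x) = ?r * (x \<bullet> x)"
    using assms(8) by (simp add: eigenvector_of_def)
  with quadratic_form_le_graph_index[of x "move_edges \<Gamma> v u W"]
    quadratic_form_move_edges[OF \<open>u \<noteq> v\<close> \<open>u \<notin> W\<close> \<open>v \<notin> W\<close> old new, of x]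
  have "?r * (x \<bullet> x) + 2 * (x $ u - x $ v) * ?S \<le> ?r' * (x \<bullet> x)"
    by simp
  then have main: "(2 * real (card W) / ?r) * ((x $ u - x $ v) * x $ v) \<le> (?r' - ?r) * (x \<bullet> x)"
    unfolding S by (simp add: algebra_simps)
  have xx: "x \<bullet> x > 0" using assms(8) by (simp add: eigenvector_of_def)
  have factor: "2 * real (card W) / ?r > 0" using pos \<open>card W > 0\<close> by simp
  have weak: "?r \<le> ?r'" if "0 \<le> (x $ u - x $ v) * x $ v"
  proof -
    have "0 \<le> (?r' - ?r) * (x \<bullet> x)"
      using main mult_nonneg_nonneg[OF less_imp_le[OF factor] that] by linarith
    then show ?thesis using zero_le_mult_iff[of "?r' - ?r" "x \<bullet> x"] xx by linarith
  qed
  have strict: "?r < ?r'" if "0 < (x $ u - x $ v) * x $ v"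
  proof -
    have "0 < (?r' - ?r) * (x \<bullet> x)"
      using main mult_pos_pos[OF factor that] by linarith
    then show ?thesis using zero_less_mult_iff[of "?r' - ?r" "x \<bullet> x"] xx by linarith
  qed
  \<comment> \<open>Both orderings in each hypothesis give the same sign of
    \<open>(x $ u - x $ v) * x $ v\<close>, so the positive and negative cases need no separate
    treatment.\<close>
  show ?thesis
    using weak strict unfolding W_def[symmetric]
    by (auto simp: zero_le_mult_iff zero_less_mult_iff)
qed

end
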